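(* Let $A,B,C,D\in\mathbb{R}^{n\times n}$ be such that $B\geq 0$, $C\leq 0$ and $I\otimes D+(A^T\otimes I)\Pi$ is a nonsingular M-matrix. Let $\mathcal{R}_T(X)=DX+X^TA-X^TBX+C$ for $X\in\mathbb{R}^{n\times n}$, and consider the fixed-point iteration $$X_0=0,\qquad DX_{k+1}+X_{k+1}^TA=X_k^TBX_k-C,\quad k\geq 0.$$ The iterates computed by this fixed-point iteration are such that $$X_{k+1}\geq X_k,\quad k\geq 0,$$ and, if there exists a nonnegative matrix $Y$ such that $\mathcal{R}_T(Y)\geq 0$, then $X_k\leq Y$ for any $k\geq 0$. Moreover, $\{X_k\}_{k\geq 0}$ converges to the minimal nonnegative solution $X_{\min}$ of $\mathcal{R}_T(X)=0$.
   Context: All matrix inequalities are entrywise: $M\geq 0$ ($M>0$) means all entries of $M$ are nonnegative (positive); $M\leq 0$ means $-M\geq 0$; $M\geq N$ means $M-N\geq 0$. A Z-matrix is a square real matrix whose off-diagonal entries are all nonpositive; it can be written as $sI-N$ with $s\in\mathbb{R}$, $N\geq 0$, and it is called an M-matrix if $s\geq\rho(N)$, where $\rho$ denotes the spectral radius. $\otimes$ is the Kronecker product, $I=I_n$ is the identity matrix, and $\Pi\in\mathbb{R}^{n^2\times n^2}$ is the permutation matrix $\Pi=\sum_{i=1}^n\sum_{j=1}^n E_{i,j}\otimes E_{j,i}$, where $E_{i,j}\in\mathbb{R}^{n\times n}$ has $(i,j)$ entry $1$ and all other entries zero. Thus $I\otimes D+(A^T\otimes I)\Pi$ is the matrix of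 the linear operator $X\mapsto DX+X^TA$. The minimal nonnegative solution of $\mathcal{R}_T(X)=0$ is the nonnegative solution $X_{\min}$ satisfying $X_{\min}\leq X$ for every nonnegative solution $X$.
   Formalization: Convergence to X_min (and existence of X_min) is stated under the condition that some nonnegative Y with R_T(Y) ≥ 0 exists; without it there may be no solution, e.g. n=1, D=1, A=0, B=1, C=−1, where x−x²−1=0 has no real root. *)

theory Defs
  imports "HOL-Analysis.Analysis"
begin

text \<open>
  The orders \<^term>\<open>(\<le>)\<close> and \<^term>\<open>(\<ge>)\<close> on the type \<^typ>\<open>real^'n^'n\<close> are the library's
  componentwise ones, hence entrywise.  The strict order of the library is not the entrywise
  one, but it is not used here.
\<close>

definition complex_eigenvalue :: "real^'n^'n \<Rightarrow> complex \<Rightarrow> bool" where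
  "complex_eigenvalue M l \<longleftrightarrow> (\<exists>v. v \<noteq> 0 \<and> map_matrix complex_of_real M *v v = l *s v)"

definition spectral_radius :: "real^'n^'n \<Rightarrow> real" where
  "spectral_radius M = (SUP l\<in>Collect (complex_eigenvalue M). cmod l)"

definition Z_matrix :: "real^'n^'n \<Rightarrow> bool" where
  "Z_matrix M \<longleftrightarrow> (\<forall>i j. i \<noteq> j \<longrightarrow> M $ i $ j \<le> 0)"

definition M_matrix :: "real^'n^'n \<Rightarrow> bool" where
  "M_matrix M \<longleftrightarrow> Z_matrix M \<and>
     (\<exists>s N. N \<ge> 0 \<and> M = s *\<^sub>R mat 1 - N \<and> s \<ge> spectral_radius N)"

text \<open>
  The rows and columns of a Kronecker product are indexed by pairs (block index, index inside
  the block), which replaces the numbering of the \<open>n\<^sup>2\<close> positions.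
\<close>

definition kronecker :: "real^'b^'a \<Rightarrow> real^'d^'c \<Rightarrow> real^('b \<times> 'd)^('a \<times> 'c)" where
  "kronecker P Q = (\<chi> r c. P $ fst r $ fst c * Q $ snd r $ snd c)"

definition unit_matrix :: "'n \<Rightarrow> 'n \<Rightarrow> real^'n^'n" where
  "unit_matrix i j = (\<chi> r c. if r = i \<and> c = j then 1 else 0)"

definition perm_matrix :: "real^('n::finite \<times> 'n)^('n \<times> 'n)" where
  "perm_matrix = (\<Sum>i\<in>UNIV. \<Sum>j\<in>UNIV. kronecker (unit_matrix i j) (unit_matrix j i))"

definition T_sylvester_matrix :: "real^'n::finite^'n \<Rightarrow> real^'n^'n \<Rightarrow> real^('n \<times> 'n)^('n \<times> 'n)" where
  "T_sylvester_matrix A D =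
     kronecker (mat 1) D + kronecker (transpose A) (mat 1) ** perm_matrix"

text \<open>
  Stacking the columns of a matrix: the block index is the column index.  With this
  vectorization the matrix above represents \<open>X \<mapsto> D X + X\<^sup>T A\<close>.
\<close>

definition vec_cols :: "real^'n::finite^'n \<Rightarrow> real^('n \<times> 'n)" where
  "vec_cols X = (\<chi> p. X $ snd p $ fst p)"

lemma perm_matrix_nth:
  "perm_matrix $ (a, b) $ (c, d) = (if a = d \<and> b = c then 1 else 0)"
proof -
  have "perm_matrix $ (a, b) $ (c, d) =
      (\<Sum>i\<in>UNIV. \<Sum>j\<in>UNIV. if i = a then (if j = c then (if a = d \<and> b = c then 1 else 0) else 0) else 0)"
    unfolding perm_matrix_def sum_component
    by (intro sum.cong refl) (auto simp: kronecker_def unit_matrix_def)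
  also have "\<dots> = (\<Sum>i\<in>UNIV. if i = a then (if a = d \<and> b = c then 1 else 0) else 0)"
    by (intro sum.cong refl) auto
  finally show ?thesis by simp
qed

lemma T_sylvester_matrix_vec_cols:
  fixes A D X :: "real^'n^'n"
  shows "T_sylvester_matrix A D *v vec_cols X = vec_cols (D ** X + transpose X ** A)"
proof -
  have sum_pair: "(\<Sum>q\<in>UNIV. f q) = (\<Sum>a\<in>UNIV. \<Sum>b\<in>UNIV. f (a, b))" for f :: "'n \<times> 'n \<Rightarrow> real"
    by (simp add: sum.cartesian_product)
  have P: "perm_matrix *v vec_cols X = vec_cols (transpose X)"
  proof -
    have "(\<Sum>c\<in>UNIV. \<Sum>d\<in>UNIV. perm_matrix $ (a, b) $ (c, d) * X $ d $ c) = X $ a $ b" for a b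
    proof -
      have "(\<Sum>c\<in>UNIV. \<Sum>d\<in>UNIV. perm_matrix $ (a, b) $ (c, d) * X $ d $ c) =
          (\<Sum>c\<in>UNIV. \<Sum>d\<in>UNIV. if d = a then (if c = b then X $ a $ b else 0) else 0)"
        by (intro sum.cong refl) (auto simp: perm_matrix_nth)
      then show ?thesis by simp
    qed
    then show ?thesis
      by (simp add: vec_eq_iff matrix_vector_mult_def vec_cols_def transpose_def sum_pair)
  qed
  have K1: "kronecker (mat 1) D *v vec_cols X = vec_cols (D ** X)"
  proof -
    have "(\<Sum>c\<in>UNIV. \<Sum>d\<in>UNIV. mat 1 $ a $ c * D $ b $ d * X $ d $ c) =
        (\<Sum>d\<in>UNIV. D $ b $ d * X $ d $ a)" for a b
    proof -
      have "(\<Sum>c\<in>UNIV. \<Sum>d\<in>UNIV. mat 1 $ a $ c * D $ b $ d * X $ d $ c) =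
          (\<Sum>c\<in>UNIV. if c = a then (\<Sum>d\<in>UNIV. D $ b $ d * X $ d $ a) else 0)"
        by (intro sum.cong refl) (auto simp: mat_def)
      then show ?thesis by simp
    qed
    then show ?thesis
      by (simp add: vec_eq_iff matrix_vector_mult_def matrix_matrix_mult_def vec_cols_def
          kronecker_def sum_pair)
  qed
  have K2: "kronecker (transpose A) (mat 1) *v vec_cols Y = vec_cols (Y ** A)" for Y
  proof -
    have "(\<Sum>c\<in>UNIV. \<Sum>d\<in>UNIV. A $ c $ a * mat 1 $ b $ d * Y $ d $ c) =
        (\<Sum>c\<in>UNIV. Y $ b $ c * A $ c $ a)" for a b
    proof -
      have "(\<Sum>c\<in>UNIV. \<Sum>d\<in>UNIV. A $ c $ a * mat 1 $ b $ d * Y $ d $ c) =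
          (\<Sum>c\<in>UNIV. \<Sum>d\<in>UNIV. if d = b then Y $ b $ c * A $ c $ a else 0)"
        by (intro sum.cong refl) (auto simp: mat_def)
      then show ?thesis by simp
    qed
    then show ?thesis
      by (simp add: vec_eq_iff matrix_vector_mult_def matrix_matrix_mult_def vec_cols_def
          kronecker_def transpose_def sum_pair)
  qed
  have "T_sylvester_matrix A D *v vec_cols X = vec_cols (D ** X) + vec_cols (transpose X ** A)"
    by (simp add: T_sylvester_matrix_def matrix_vector_mult_add_rdistrib
        matrix_vector_mul_assoc[symmetric] P K1 K2)
  then show ?thesis
    by (simp add: vec_cols_def vec_eq_iff)
qed

definition T_riccati ::
    "real^'n^'n \<Rightarrow> real^'n^'n \<Rightarrow> real^'n^'n \<Rightarrow> real^'n^'n \<Rightarrow> real^'n^'n \<Rightarrow> real^'n^'n" where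
  "T_riccati A B C D X = D ** X + transpose X ** A - transpose X ** B ** X + C"

definition minimal_nonneg_solution ::
    "real^'n^'n \<Rightarrow> real^'n^'n \<Rightarrow> real^'n^'n \<Rightarrow> real^'n^'n \<Rightarrow> real^'n^'n \<Rightarrow> bool" where
  "minimal_nonneg_solution A B C D S \<longleftrightarrow>
     S \<ge> 0 \<and> T_riccati A B C D S = 0 \<and>
     (\<forall>X. X \<ge> 0 \<and> T_riccati A B C D X = 0 \<longrightarrow> S \<le> X)"

end

theory Submission
  imports Defs
begin

text \<open>
  The linear operator \<open>L X = D X + X\<^sup>T A\<close> is inverse positive: \<open>L X \<le> L Y\<close> implies \<open>X \<le> Y\<close>
  (\<open>T_sylvester_monotone\<close>).  The iteration reads \<open>L X\<^sub>k\<^sub>+\<^sub>1 = Q X\<^sub>k - C\<close>, where the quadratic term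
  \<open>Q X = X\<^sup>T B X\<close> is monotone on nonnegative matrices, and a matrix \<open>Y\<close> with nonnegative
  residual is one with \<open>Q Y - C \<le> L Y\<close>.  Monotonicity of the iterates and the bound by \<open>Y\<close> are
  then inductions that compare right-hand sides and cancel \<open>L\<close>.  If such a \<open>Y\<close> exists, the
  iterates increase entrywise to a limit; continuity makes the limit a solution, and it is
  minimal because each nonnegative solution is itself an admissible \<open>Y\<close>.

  Inverse positivity of \<open>L\<close> is the fact that a nonsingular M-matrix \<open>s I - N\<close> is monotone, which is
  derived here without Perron-Frobenius theory.  The definition of an M-matrix only says that no
  eigenvalue of \<open>N\<close> exceeds \<open>s\<close> in modulus; with nonsingularity, \<open>t I - N\<close> is invertible for
  every \<open>t \<ge> s\<close>.  The link between invertibility and sign is semipositivity, the existence of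
  \<open>w \<ge> 0\<close> with \<open>M w > 0\<close>.  For a Z-matrix it implies monotonicity
  (\<open>semipositive_Z_matrix_monotone\<close>), and it propagates from large \<open>t\<close> down to \<open>s\<close>, for it can
  only be lost at a \<open>t\<close> where \<open>t I - N\<close> is singular (\<open>semipositive_if_invertible_above\<close>).
\<close>

section \<open>Z-matrices and inverse positivity\<close>

lemma Z_matrix_mult_nonpos_at_zero:
  fixes M :: "real^'m^'m"
  assumes "Z_matrix M" and "\<And>j. z $ j \<ge> 0" and "z $ i = 0"
  shows "(M *v z) $ i \<le> 0"
proof -
  have "M $ i $ j * z $ j \<le> 0" for j
    using assms by (cases "j = i") (auto simp: Z_matrix_def mult_nonpos_nonneg)
  then show ?thesis
    by (simp add: matrix_vector_mult_def sum_nonpos)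
qed

definition semipositive :: "real^'m^'m \<Rightarrow> bool" where
  "semipositive M \<longleftrightarrow> (\<exists>w. (\<forall>i. w $ i \<ge> 0) \<and> (\<forall>i. (M *v w) $ i > 0))"

text \<open>
  Let \<open>w\<close> witness semipositivity; it is in fact strictly positive.  If \<open>x\<close> had a negative entry,
  adding the right multiple of \<open>w\<close> to \<open>x\<close> would give a nonnegative vector with a zero entry
  whose image is strictly positive, which the sign pattern of a Z-matrix forbids at that entry.
\<close>

lemma semipositive_Z_matrix_monotone:
  fixes M :: "real^'m^'m"
  assumes Z: "Z_matrix M" and "semipositive M" and Mx: "\<And>i. (M *v x) $ i \<ge> 0"
  shows "x $ i \<ge> 0"
proof (rule ccontr)
  assume neg: "\<not> x $ i \<ge> 0"
  obtain w where w0: "\<And>i. w $ i \<ge> 0" and Mw: "\<And>i. (M *v w) $ i > 0"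
    using assms(2) by (auto simp: semipositive_def)
  have w: "w $ k > 0" for k
    using Z_matrix_mult_nonpos_at_zero[OF Z w0, of k] Mw[of k] w0[of k]
    by (metis less_eq_real_def not_less)
  (* The smallest ratio is the multiple of w at which x - q w first touches zero. *)
  define q where "q k = x $ k / w $ k" for k
  have "\<exists>k. \<forall>j. q k \<le> q j"
    using ex_is_arg_min_if_finite[of "UNIV :: 'm set" q] by (auto simp: is_arg_min_linorder)
  then obtain k where k: "\<And>j. q k \<le> q j" by blast
  have "q i < 0"
    using neg w[of i] by (simp add: q_def divide_neg_pos)
  with k[of i] have qk: "q k < 0" by simp
  define z where "z = x - q k *s w"
  have "z $ j \<ge> 0" for j
    using k[of j] w[of j] by (simp add: z_def q_def[of j] field_simps)
  moreover have "z $ k = 0"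
    using w[of k] by (simp add: z_def q_def)
  ultimately have "(M *v z) $ k \<le> 0"
    by (rule Z_matrix_mult_nonpos_at_zero[OF Z])
  moreover have "(M *v z) $ k = (M *v x) $ k - q k * (M *v w) $ k"
    by (simp add: z_def matrix_vector_mult_diff_distrib vector_scalar_commute)
  moreover have "q k * (M *v w) $ k < 0"
    using qk Mw[of k] by (simp add: mult_neg_pos)
  ultimately show False
    using Mx[of k] by linarith
qed

lemma pos_vector_perturbation:
  fixes u v :: "real^'m"
  assumes "\<And>i. u $ i > 0"
  shows "\<exists>d>0. \<forall>e. \<bar>e\<bar> \<le> d \<longrightarrow> (\<forall>i. u $ i + e * v $ i > 0)"
proof -
  have "((\<lambda>e. u $ i + e * v $ i) \<longlongrightarrow> u $ i + 0 * v $ i) (nhds 0)" for i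
    by (intro tendsto_intros filterlim_ident)
  then have "\<forall>\<^sub>F e in nhds 0. \<forall>i\<in>UNIV. u $ i + e * v $ i > 0"
    by (intro eventually_ball_finite) (auto intro!: order_tendstoD(1) simp: assms)
  then obtain d where "d > 0" and d: "\<And>e. dist e 0 < d \<Longrightarrow> \<forall>i. u $ i + e * v $ i > 0"
    by (auto simp: eventually_nhds_metric)
  then show ?thesis
    by (intro exI[of _ "d / 2"]) auto
qed

lemma shifted_mult:
  fixes N :: "real^'m^'m"
  shows "((t *\<^sub>R mat 1 - N) *v w) $ i = t * w $ i - (N *v w) $ i"
  by (simp add: matrix_vector_mult_diff_rdistrib scaleR_matrix_vector_assoc[symmetric])

lemma shifted_Z_matrix: "N \<ge> 0 \<Longrightarrow> Z_matrix (t *\<^sub>R mat 1 - N)"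
  by (auto simp: Z_matrix_def less_eq_vec_def mat_def)

text \<open>
  Let \<open>t\<close> be the infimum of the parameters \<open>t' \<ge> s\<close> at which \<open>t' I - N\<close> is semipositive; the
  all-ones vector shows that large parameters qualify.  The solution \<open>w\<close> of \<open>(t I - N) w = 1\<close>
  satisfies \<open>((t + e) I - N) w = 1 + e w\<close>, which is positive for small \<open>\<bar>e\<bar>\<close>.  For suitable
  \<open>e \<ge> 0\<close>, monotonicity at \<open>t + e\<close> yields \<open>w \<ge> 0\<close>; then \<open>w\<close> witnesses semipositivity at \<open>t\<close>
  and also slightly below \<open>t\<close>, so the infimum can only be \<open>s\<close>.
\<close>

lemma semipositive_if_invertible_above:
  fixes N :: "real^'m^'m"
  assumes N: "N \<ge> 0" and inv: "\<And>t. t \<ge> s \<Longrightarrow> invertible (t *\<^sub>R mat 1 - N)"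
  shows "semipositive (s *\<^sub>R mat 1 - N)"
proof -
  define S where "S = {t. t \<ge> s \<and> semipositive (t *\<^sub>R mat 1 - N)}"
  define b where "b = Max (insert s (range (\<lambda>i. (N *v 1) $ i))) + 1"
  have "s < b" and b: "(N *v 1) $ i < b" for i
    unfolding b_def by (rule le_less_trans[OF Max_ge less_add_one]; simp)+
  have "((b *\<^sub>R mat 1 - N) *v 1) $ i > 0" for i
    unfolding shifted_mult using b[of i] by simp
  then have "semipositive (b *\<^sub>R mat 1 - N)"
    unfolding semipositive_def by (intro exI[of _ 1]) simp
  with \<open>s < b\<close> have "b \<in> S" by (simp add: S_def)
  then have ne: "S \<noteq> {}" by auto
  have bdd: "bdd_below S" by (auto simp: S_def)
  define t where "t = Inf S"
  have st: "s \<le> t"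
    unfolding t_def by (rule cInf_greatest[OF ne]) (auto simp: S_def)
  obtain w where w: "(t *\<^sub>R mat 1 - N) *v w = 1"
    using inv[OF st] unfolding invertible_def
    by (metis matrix_vector_mul_assoc matrix_vector_mul_lid)
  have wi: "t * w $ i - (N *v w) $ i = 1" for i
    using shifted_mult[of t N w i] w by simp
  obtain d where "d > 0" and d: "\<And>e i. \<bar>e\<bar> \<le> d \<Longrightarrow> (1 :: real^'m) $ i + e * w $ i > 0"
    using pos_vector_perturbation[of 1 w] by auto
  obtain t' where t': "t' \<in> S" "t' < t + d"
    using cInf_lessD[OF ne, of "t + d"] \<open>d > 0\<close> by (auto simp: t_def)
  have tt': "t \<le> t'"
    unfolding t_def using t'(1) bdd by (rule cInf_lower)
  have "((t' *\<^sub>R mat 1 - N) *v w) $ i \<ge> 0" for i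
    using d[of "t' - t" i] t'(2) tt' wi[of i] unfolding shifted_mult
    by (simp add: algebra_simps)
  then have w0: "w $ i \<ge> 0" for i
    using semipositive_Z_matrix_monotone[OF shifted_Z_matrix[OF N]] t'(1) by (auto simp: S_def)
  have down: "semipositive ((t - e) *\<^sub>R mat 1 - N)" if "0 \<le> e" "e \<le> d" for e
  proof -
    have "(((t - e) *\<^sub>R mat 1 - N) *v w) $ i > 0" for i
      using d[of "- e" i] that wi[of i] unfolding shifted_mult by (simp add: algebra_simps)
    then show ?thesis using w0 by (auto simp: semipositive_def)
  qed
  have "t = s"
  proof (rule ccontr)
    assume "t \<noteq> s"
    define e where "e = min d (t - s)"
    have "e > 0" "e \<le> d" "s \<le> t - e" using \<open>d > 0\<close> st \<open>t \<noteq> s\<close> by (auto simp: e_def)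
    then have "t - e \<in> S" using down by (auto simp: S_def)
    then have "t \<le> t - e" unfolding t_def using bdd by (rule cInf_lower)
    with \<open>e > 0\<close> show False by simp
  qed
  with down[of 0] \<open>d > 0\<close> show ?thesis by simp
qed

section \<open>Nonsingular M-matrices\<close>

text \<open>
  The spectral radius is a supremum of reals, so it bounds the eigenvalues only once these are
  known to be bounded.  The bound comes from comparing the entries of \<open>N v = l v\<close> at an
  index where \<open>v\<close> has largest modulus.
\<close>

lemma complex_eigenvalue_bound:
  fixes N :: "real^'m^'m"
  assumes "complex_eigenvalue N l"
  shows "cmod l \<le> (\<Sum>i\<in>UNIV. \<Sum>j\<in>UNIV. \<bar>N $ i $ j\<bar>)"
proof -
  obtain v where v: "v \<noteq> 0" "map_matrix complex_of_real N *v v = l *s v"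
    using assms by (auto simp: complex_eigenvalue_def)
  define m where "m = Max (range (\<lambda>i. cmod (v $ i)))"
  have m: "cmod (v $ i) \<le> m" for i by (auto simp: m_def)
  have "m \<in> range (\<lambda>i. cmod (v $ i))" unfolding m_def by (rule Max_in) auto
  then obtain k where k: "cmod (v $ k) = m" by auto
  have "m > 0"
  proof -
    obtain i where "v $ i \<noteq> 0" using v(1) by (auto simp: vec_eq_iff)
    then show ?thesis using m[of i] by (meson less_le_trans zero_less_norm_iff)
  qed
  have "l * v $ k = (\<Sum>j\<in>UNIV. complex_of_real (N $ k $ j) * v $ j)"
    using arg_cong[OF v(2), of "\<lambda>u. u $ k"] by (simp add: matrix_vector_mult_def map_matrix_def)
  then have "cmod l * m = cmod (\<Sum>j\<in>UNIV. complex_of_real (N $ k $ j) * v $ j)"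
    using k by (metis norm_mult)
  also have "\<dots> \<le> (\<Sum>j\<in>UNIV. \<bar>N $ k $ j\<bar> * m)"
    by (rule sum_norm_le) (simp add: norm_mult m mult_left_mono)
  also have "\<dots> = (\<Sum>j\<in>UNIV. \<bar>N $ k $ j\<bar>) * m"
    by (simp add: sum_distrib_right)
  finally have "cmod l \<le> (\<Sum>j\<in>UNIV. \<bar>N $ k $ j\<bar>)"
    using \<open>m > 0\<close> by simp
  also have "\<dots> \<le> (\<Sum>i\<in>UNIV. \<Sum>j\<in>UNIV. \<bar>N $ i $ j\<bar>)"
    by (rule member_le_sum[of k UNIV "\<lambda>i. \<Sum>j\<in>UNIV. \<bar>N $ i $ j\<bar>"]) (auto intro: sum_nonneg)
  finally show ?thesis .
qed

lemma invertible_above_spectral_radius: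
  fixes N :: "real^'m^'m"
  assumes "t > spectral_radius N"
  shows "invertible (t *\<^sub>R mat 1 - N)"
proof (rule ccontr)
  assume "\<not> invertible (t *\<^sub>R mat 1 - N)"
  then obtain x where x: "x \<noteq> 0" "(t *\<^sub>R mat 1 - N) *v x = 0"
    by (metis invertible_left_inverse matrix_left_invertible_ker)
  have Nx: "(N *v x) $ i = t * x $ i" for i
    using shifted_mult[of t N x i] x(2) by simp
  define v where "v = (\<chi> i. complex_of_real (x $ i))"
  have "v \<noteq> 0" using x(1) by (auto simp: v_def vec_eq_iff)
  moreover have "map_matrix complex_of_real N *v v = complex_of_real t *s v"
  proof -
    have "(map_matrix complex_of_real N *v v) $ i = complex_of_real ((N *v x) $ i)" for i
      by (simp add: v_def matrix_vector_mult_def map_matrix_def)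
    then show ?thesis by (simp add: vec_eq_iff Nx v_def)
  qed
  ultimately have "complex_eigenvalue N (complex_of_real t)"
    by (auto simp: complex_eigenvalue_def)
  then have "cmod (complex_of_real t) \<le> spectral_radius N"
    unfolding spectral_radius_def
    by (intro cSUP_upper) (auto intro!: bdd_aboveI2 complex_eigenvalue_bound)
  with assms show False by simp
qed

text \<open>
  Nonsingularity is what covers the boundary case \<open>s = spectral_radius N\<close>: it supplies
  invertibility of \<open>t I - N\<close> at the left endpoint \<open>t = s\<close>.
\<close>

lemma nonsingular_M_matrix_monotone:
  fixes M :: "real^'m^'m"
  assumes "M_matrix M" and "invertible M" and "M *v x \<ge> 0"
  shows "x \<ge> 0"
proof -
  obtain s N where N: "N \<ge> 0" and M: "M = s *\<^sub>R mat 1 - N" and s: "s \<ge> spectral_radius N"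
    using assms(1) by (auto simp: M_matrix_def)
  have "invertible (t *\<^sub>R mat 1 - N)" if "t \<ge> s" for t
    using that s M assms(2) invertible_above_spectral_radius[of N t] by (cases "t = s") auto
  then have "semipositive M"
    unfolding M by (rule semipositive_if_invertible_above[OF N])
  then show ?thesis
    using assms(1,3) semipositive_Z_matrix_monotone[of M x]
    by (auto simp: M_matrix_def less_eq_vec_def)
qed

section \<open>The fixed-point iteration\<close>

text \<open>
  Monotonicity of the \<open>n\<^sup>2 \<times> n\<^sup>2\<close> matrix, carried over to \<open>n \<times> n\<close> matrices by the
  order-preserving vectorization.
\<close>

lemma T_sylvester_monotone:
  fixes A D X Y :: "real^'n^'n"
  assumes "M_matrix (T_sylvester_matrix A D)" and "invertible (T_sylvester_matrix A D)"
    and "D ** X + transpose X ** A \<le> D ** Y + transpose Y ** A"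
  shows "X \<le> Y"
proof -
  have diff: "vec_cols P - vec_cols Q = vec_cols (P - Q)" for P Q :: "real^'n^'n"
    by (simp add: vec_cols_def vec_eq_iff)
  have nonneg: "vec_cols P \<ge> 0 \<longleftrightarrow> P \<ge> 0" for P :: "real^'n^'n"
    by (auto simp: vec_cols_def less_eq_vec_def)
  have "T_sylvester_matrix A D *v vec_cols (Y - X) =
      vec_cols (D ** Y + transpose Y ** A - (D ** X + transpose X ** A))"
    unfolding diff[symmetric] matrix_vector_mult_diff_distrib T_sylvester_matrix_vec_cols ..
  moreover have "D ** Y + transpose Y ** A - (D ** X + transpose X ** A) \<ge> 0"
    using assms(3) by (simp add: less_eq_vec_def)
  ultimately have "T_sylvester_matrix A D *v vec_cols (Y - X) \<ge> 0"
    by (simp only: nonneg)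
  then have "vec_cols (Y - X) \<ge> 0"
    by (rule nonsingular_M_matrix_monotone[OF assms(1,2)])
  then show ?thesis
    unfolding nonneg by (simp add: less_eq_vec_def)
qed

lemma matrix_mult_mono:
  fixes P P' :: "real^'m^'k" and Q Q' :: "real^'l^'m"
  assumes "0 \<le> P" "P \<le> P'" "0 \<le> Q" "Q \<le> Q'"
  shows "P ** Q \<le> P' ** Q'"
proof -
  have "0 \<le> P'" using assms(1,2) by simp
  with assms show ?thesis
    unfolding less_eq_vec_def matrix_matrix_mult_def by (auto intro!: sum_mono mult_mono)
qed

lemma quadratic_term_mono:
  fixes B X Y :: "real^'n^'n"
  assumes "0 \<le> B" "0 \<le> X" "X \<le> Y"
  shows "transpose X ** B ** X \<le> transpose Y ** B ** Y"
proof -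
  have tr: "0 \<le> transpose X" "transpose X \<le> transpose Y"
    using assms by (auto simp: less_eq_vec_def transpose_def)
  have "0 \<le> transpose X ** B"
    using tr assms(1) unfolding less_eq_vec_def matrix_matrix_mult_def by (auto intro!: sum_nonneg)
  with tr assms show ?thesis
    by (intro matrix_mult_mono) auto
qed

lemma tendsto_matrix_mult:
  fixes f :: "'a \<Rightarrow> real^'m^'k" and g :: "'a \<Rightarrow> real^'l^'m"
  shows "(f \<longlongrightarrow> P) F \<Longrightarrow> (g \<longlongrightarrow> Q) F \<Longrightarrow> ((\<lambda>x. f x ** g x) \<longlongrightarrow> P ** Q) F"
  unfolding matrix_matrix_mult_def
  by (intro tendsto_vec_lambda tendsto_sum tendsto_mult tendsto_vec_nth)

lemma tendsto_transpose:
  fixes f :: "'a \<Rightarrow> real^'m^'k"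
  shows "(f \<longlongrightarrow> P) F \<Longrightarrow> ((\<lambda>x. transpose (f x)) \<longlongrightarrow> transpose P) F"
  unfolding transpose_def by (intro tendsto_vec_lambda tendsto_vec_nth)

lemma bounded_increasing_matrices_converge:
  fixes X :: "nat \<Rightarrow> real^'m^'k"
  assumes "\<And>k. X k \<le> X (Suc k)" and "\<And>k. X k \<le> Y"
  obtains L where "X \<longlonglongrightarrow> L" and "\<And>k. X k \<le> L"
proof -
  have inc: "incseq (\<lambda>k. X k $ i $ j)" for i j
    using assms(1) by (auto simp: less_eq_vec_def intro!: incseq_SucI)
  have bd: "X k $ i $ j \<le> Y $ i $ j" for k i j
    using assms(2) by (auto simp: less_eq_vec_def)
  have "\<exists>l. (\<lambda>k. X k $ i $ j) \<longlonglongrightarrow> l \<and> (\<forall>k. X k $ i $ j \<le> l)" for i j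
    using incseq_convergent[OF inc[of i j]] bd[of _ i j] by metis
  then obtain L where L: "\<And>i j. (\<lambda>k. X k $ i $ j) \<longlonglongrightarrow> L i j" "\<And>i j k. X k $ i $ j \<le> L i j"
    by metis
  show ?thesis
  proof
    show "X \<longlonglongrightarrow> (\<chi> i j. L i j)"
      using L(1) by (intro vec_tendstoI) simp
    show "X k \<le> (\<chi> i j. L i j)" for k
      using L(2) by (simp add: less_eq_vec_def)
  qed
qed

theorem theorem2p1:
  fixes A B C D :: "real^'n^'n" and X :: "nat \<Rightarrow> real^'n^'n"
  assumes "B \<ge> 0" and "C \<le> 0"
    and "M_matrix (T_sylvester_matrix A D)"
    and "invertible (T_sylvester_matrix A D)"
    and "X 0 = 0"
    and "\<And>k. D ** X (Suc k) + transpose (X (Suc k)) ** A = transpose (X k) ** B ** X k - C"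
  shows "(\<forall>k. X (Suc k) \<ge> X k) \<and>
         (\<forall>Y. Y \<ge> 0 \<and> T_riccati A B C D Y \<ge> 0 \<longrightarrow> (\<forall>k. X k \<le> Y)) \<and>
         ((\<exists>Y. Y \<ge> 0 \<and> T_riccati A B C D Y \<ge> 0) \<longrightarrow>
            (\<exists>X\<^sub>m\<^sub>i\<^sub>n. minimal_nonneg_solution A B C D X\<^sub>m\<^sub>i\<^sub>n \<and> X \<longlonglongrightarrow> X\<^sub>m\<^sub>i\<^sub>n))"
proof -
  note step = assms(6) and solve_mono = T_sylvester_monotone[OF assms(3,4)]
  have zero: "D ** 0 + transpose 0 ** A = (0 :: real^'n^'n)"
    by (simp add: matrix_matrix_mult_def transpose_def vec_eq_iff)
  have incr: "0 \<le> X k \<and> X k \<le> X (Suc k)" for k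
  proof (induction k)
    case 0
    have "D ** X 0 + transpose (X 0) ** A \<le> D ** X (Suc 0) + transpose (X (Suc 0)) ** A"
      using assms(2) unfolding step assms(5) zero
      by (simp add: matrix_matrix_mult_def transpose_def less_eq_vec_def)
    then have "X 0 \<le> X (Suc 0)" by (rule solve_mono)
    then show ?case using assms(5) by simp
  next
    case (Suc k)
    then have "transpose (X k) ** B ** X k \<le> transpose (X (Suc k)) ** B ** X (Suc k)"
      by (intro quadratic_term_mono assms(1)) auto
    then have "X (Suc k) \<le> X (Suc (Suc k))"
      by - (rule solve_mono, simp add: step diff_right_mono)
    then show ?case using Suc by auto
  qed
  have upper: "X k \<le> Y" if Y: "Y \<ge> 0" "T_riccati A B C D Y \<ge> 0" for Y k
  proof (induction k)
    case 0
    show ?case using Y(1) assms(5) by simp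
  next
    case (Suc k)
    then have "transpose (X k) ** B ** X k \<le> transpose Y ** B ** Y"
      using incr by (intro quadratic_term_mono assms(1)) auto
    moreover have "transpose Y ** B ** Y - C \<le> D ** Y + transpose Y ** A"
      using Y(2) by (simp add: T_riccati_def algebra_simps)
    ultimately have "transpose (X k) ** B ** X k - C \<le> D ** Y + transpose Y ** A"
      by (meson diff_right_mono order_trans)
    then show ?case by - (rule solve_mono, simp add: step)
  qed
  have limit: "\<exists>S. minimal_nonneg_solution A B C D S \<and> X \<longlonglongrightarrow> S"
    if Y: "Y \<ge> 0" "T_riccati A B C D Y \<ge> 0" for Y
  proof -
    obtain S where S: "X \<longlonglongrightarrow> S" and XS: "\<And>k. X k \<le> S"
      using bounded_increasing_matrices_converge[of X Y] incr upper[OF Y] by blast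
    have "(\<lambda>k. D ** X (Suc k) + transpose (X (Suc k)) ** A) \<longlonglongrightarrow> D ** S + transpose S ** A"
      by (intro tendsto_intros tendsto_matrix_mult tendsto_transpose LIMSEQ_Suc S)
    moreover have "(\<lambda>k. transpose (X k) ** B ** X k - C) \<longlonglongrightarrow> transpose S ** B ** S - C"
      by (intro tendsto_intros tendsto_matrix_mult tendsto_transpose S)
    ultimately have "D ** S + transpose S ** A = transpose S ** B ** S - C"
      unfolding step by (rule LIMSEQ_unique)
    then have sol: "T_riccati A B C D S = 0"
      by (simp add: T_riccati_def)
    have "S \<le> Z" if "Z \<ge> 0" "T_riccati A B C D Z = 0" for Z
    proof -
      have "X k $ i $ j \<le> Z $ i $ j" for k i j
        using upper[of Z k] that by (simp add: less_eq_vec_def)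
      moreover have "(\<lambda>k. X k $ i $ j) \<longlonglongrightarrow> S $ i $ j" for i j
        by (intro tendsto_vec_nth S)
      ultimately show ?thesis
        unfolding less_eq_vec_def by (intro allI LIMSEQ_le_const2[where X = "\<lambda>k. X k $ _ $ _"]) auto
    qed
    moreover have "S \<ge> 0" using XS[of 0] assms(5) by simp
    ultimately show ?thesis
      using S sol by (auto simp: minimal_nonneg_solution_def)
  qed
  show ?thesis using incr upper limit by blast
qed

end
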